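(* Consider the equation $$x'(t)=\sum_{k=1}^{M}\lambda_k r_k(t)\frac{x^{m_k}(t-\tau_k(t))}{1+x^{n_k}(t-\mu_k(t))}-b(t)x(t)\qquad( * )$$ and assume that $m_k<n_k+1$ for all $k\in\{1,\dots,M\}$. \begin{enumerate} \item Let $m_k>1$ for all $k$ and assume there exists a constant $\gamma_1$ such that $\alpha(\gamma_1,t)>0$ for all $t$. Then $( * )$ admits at least $2$ positive $T$-periodic solutions. \item Let $m_k\ge 1$ for all $k$, and $m_i=1$, $m_j>1$ for some $i,j$. Assume that $\sum_{k\in M_2}\lambda_k r_k(t)e^{C}<b(t)$ for all $t$ and that there exists a constant $\gamma_1$ such that $\alpha(\gamma_1,t)>0$ for all $t$. Then $( * )$ admits at least $2$ positive $T$-periodic solutions. \item Let $0<m_i<1$ and $m_j>1$ for some $i,j$. Assume there exist constants $\gamma_1<\gamma_2$ such that $\alpha(\gamma_2,t)>0>\beta(\gamma_1,t)$ for all $t$. Then $( * )$ admits at least $3$ positive $T$-periodic solutions. \end{enumerate}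
   Context: Let $T>0$ and let $M\ge 1$ be an integer. For $k=1,\dots,M$, let $\lambda_k,m_k,n_k$ be positive real constants, and let $r_k,\tau_k,\mu_k$ and $b$ be continuous, positive, $T$-periodic functions $\mathbb{R}\to\mathbb{R}$. Set $C:=\int_0^T b(t)\,dt$ and $M_2:=\{k: m_k=1\}$. For $\gamma,t\in\mathbb{R}$ define $$\alpha(\gamma,t):=\sum_{k=1}^{M}\lambda_k r_k(t)\frac{e^{(m_k-1)\gamma}e^{-Cm_k}}{1+e^{n_k(\gamma+C)}}-b(t),\qquad \beta(\gamma,t):=\sum_{k=1}^{M}\lambda_k r_k(t)\frac{e^{(m_k-1)\gamma}e^{Cm_k}}{1+e^{n_k(\gamma-C)}}-b(t).$$ The constants $\gamma_i$ are real. Here $x^{m}(s)$ means $(x(s))^{m}$. A positive $T$-periodic solution is a $T$-periodic differentiable function $x:\mathbb{R}\to(0,\infty)$ satisfying the equation for all $t\in\mathbb{R}$; solutions are counted as distinct functions. *)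

theory Defs
  imports "HOL-Analysis.Analysis" "HOL-Library.Periodic_Fun"
begin

definition continuous_positive_periodic :: "real \<Rightarrow> (real \<Rightarrow> real) \<Rightarrow> bool" where
  "continuous_positive_periodic T f \<longleftrightarrow>
     continuous_on UNIV f \<and> (\<forall>t. 0 < f t) \<and> periodic_fun_simple f T"

definition total_decay :: "real \<Rightarrow> (real \<Rightarrow> real) \<Rightarrow> real" where
  "total_decay T b = integral {0..T} b"

definition alpha ::
  "real \<Rightarrow> nat \<Rightarrow> (nat \<Rightarrow> real) \<Rightarrow> (nat \<Rightarrow> real) \<Rightarrow> (nat \<Rightarrow> real) \<Rightarrow>
   (nat \<Rightarrow> real \<Rightarrow> real) \<Rightarrow> (real \<Rightarrow> real) \<Rightarrow> real \<Rightarrow> real \<Rightarrow> real" where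
  "alpha T M lam m n r b \<gamma> t =
     (let C = total_decay T b in
       (\<Sum>k = 1..M. lam k * r k t *
          (exp ((m k - 1) * \<gamma>) * exp (- C * m k) / (1 + exp (n k * (\<gamma> + C))))) - b t)"

definition beta ::
  "real \<Rightarrow> nat \<Rightarrow> (nat \<Rightarrow> real) \<Rightarrow> (nat \<Rightarrow> real) \<Rightarrow> (nat \<Rightarrow> real) \<Rightarrow>
   (nat \<Rightarrow> real \<Rightarrow> real) \<Rightarrow> (real \<Rightarrow> real) \<Rightarrow> real \<Rightarrow> real \<Rightarrow> real" where
  "beta T M lam m n r b \<gamma> t =
     (let C = total_decay T b in
       (\<Sum>k = 1..M. lam k * r k t *
          (exp ((m k - 1) * \<gamma>) * exp (C * m k) / (1 + exp (n k * (\<gamma> - C))))) - b t)"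

text \<open>The exponents are real, hence \<open>powr\<close>, which is only used at positive bases.\<close>

definition positive_periodic_solutions ::
  "real \<Rightarrow> nat \<Rightarrow> (nat \<Rightarrow> real) \<Rightarrow> (nat \<Rightarrow> real) \<Rightarrow> (nat \<Rightarrow> real) \<Rightarrow>
   (nat \<Rightarrow> real \<Rightarrow> real) \<Rightarrow> (nat \<Rightarrow> real \<Rightarrow> real) \<Rightarrow> (nat \<Rightarrow> real \<Rightarrow> real) \<Rightarrow>
   (real \<Rightarrow> real) \<Rightarrow> (real \<Rightarrow> real) set" where
  "positive_periodic_solutions T M lam m n r \<tau> \<mu> b =
     {x. (\<forall>t. 0 < x t) \<and> periodic_fun_simple x T \<and>
         (\<forall>t. (x has_real_derivative
                 (\<Sum>k = 1..M. lam k * r k t *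
                    (x (t - \<tau> k t) powr m k / (1 + x (t - \<mu> k t) powr n k))) - b t * x t)
               (at t))}"

text \<open>Not \<open>c \<le> card A\<close>, because \<open>card\<close> is \<open>0\<close> on infinite sets.\<close>

definition has_at_least :: "nat \<Rightarrow> 'a set \<Rightarrow> bool" where
  "has_at_least c A \<longleftrightarrow> (\<exists>S \<subseteq> A. finite S \<and> card S = c)"

end

theory Submission
  imports Defs "HOL-Complex_Analysis.Great_Picard"
begin

text \<open>For \<open>y = ln x\<close> the equation reads \<open>y'(t) = H(t, y(t), y(t - \<tau>), y(t - \<mu>)) \<ge> -b(t)\<close>, so a periodic
  solution oscillates by at most \<open>C\<close>. Hence a solution at the level \<open>\<gamma>\<close> would have to increase there if
  \<open>\<alpha>(\<gamma>, \<cdot>) > 0\<close> and to decrease if \<open>\<beta>(\<gamma>, \<cdot>) < 0\<close>: such a level is never touched by a periodic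
  solution. Between two consecutive levels with opposite signs there is a solution: clip \<open>y\<close> to the
  band, clip the delayed values to distance \<open>C\<close> from the present value, and solve
  \<open>y' = H + a (clip y - y)\<close> by Schauder's theorem, with \<open>a = 1\<close> if the field points into the band and
  \<open>a = -1\<close> if it points out of it. The same sign argument at the extrema of \<open>y\<close> shows that the fixed
  point stays inside the band, where all clipping is inactive. The growth conditions on \<open>m\<close> and \<open>n\<close>
  provide the missing outer levels near \<open>\<plusminus>\<infinity>\<close>.

  Schauder's theorem for periodic functions is reduced to Kuhn's combinatorial lemma, first in the
  Hilbert cube, whose dimension need not be fixed by a type, and then by sampling at finitely many points.\<close>

section \<open>Fixed point theorems\<close>

text \<open>Tychonoff's theorem, transferred from the product topology to the topology of the
  function type.\<close>

lemma compact_real_cube: "compact {x :: nat \<Rightarrow> real. \<forall>i. x i \<in> {a..b}}"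
proof -
  have "compactin (product_topology (\<lambda>_. euclidean) UNIV) (PiE UNIV (\<lambda>_::nat. {a..b}))"
    by (subst compactin_PiE) auto
  moreover have "PiE UNIV (\<lambda>_::nat. {a..b}) = {x. \<forall>i. x i \<in> {a..b}}"
    by auto
  ultimately show ?thesis
    by (simp add: euclidean_product_topology)
qed

lemma tendsto_coordinate: "(X \<longlongrightarrow> x) F \<Longrightarrow> ((\<lambda>k. X k i) \<longlongrightarrow> x i) F"
  for X :: "_ \<Rightarrow> nat \<Rightarrow> real"
  using continuous_on_tendsto_compose[OF continuous_on_product_coordinates[of i], of X x F] by simp

lemma tendsto_if_coordinates:
  fixes X :: "_ \<Rightarrow> nat \<Rightarrow> real"
  assumes "\<And>i. ((\<lambda>k. X k i) \<longlongrightarrow> x i) F"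
  shows "(X \<longlongrightarrow> x) F"
  using assms limitin_componentwise[of "\<lambda>_. euclidean" UNIV X x F]
  by (simp add: euclidean_product_topology)

text \<open>Kuhn's lemma yields, for every p, a grid cell of side 1/p such that for each i < p some
  vertex is not lowered by f in coordinate i and another one is not raised. A subsequence of the
  cells shrinks to a point x, and continuity turns the two inequalities into f x i = x i. Every
  coordinate is covered as soon as p exceeds it.\<close>

lemma hilbert_cube_fixed_point:
  fixes f :: "(nat \<Rightarrow> real) \<Rightarrow> nat \<Rightarrow> real"
  defines "Q \<equiv> {x. \<forall>i. x i \<in> {0..1}}"
  assumes cont: "continuous_on Q f" and maps: "f ` Q \<subseteq> Q"
  obtains x where "x \<in> Q" "f x = x"
proof -
  define v where "v p z = (\<lambda>i. if i < p then real (z i) / real p else 0)" for p :: nat and z :: "nat \<Rightarrow> nat"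
  \<comment> \<open>Kuhn's lemma demands label 1 on the upper face, hence the disjunct
    \<open>z i = p\<close>. On the lower face the label is 0 because f is nonnegative.\<close>
  define label where "label p z i = (if z i = p \<or> f (v p z) i < v p z i then 1 else 0 :: nat)"
    for p :: nat and z i
  have vQ: "v p z \<in> Q" if "\<forall>i<p. z i \<le> p" for p z
    using that by (auto simp: v_def Q_def divide_simps)
  have fQ: "f x i \<in> {0..1}" if "x \<in> Q" for x i
    using maps that unfolding Q_def by blast
  \<comment> \<open>The dimension and the number of subdivisions are both p, so that one limit
    refines the grid and exhausts the coordinates.\<close>
  have "\<exists>q. (\<forall>i<p. q i < p) \<and> (\<forall>i<p. \<exists>r s. (\<forall>j<p. q j \<le> r j \<and> r j \<le> q j + 1) \<and>
      (\<forall>j<p. q j \<le> s j \<and> s j \<le> q j + 1) \<and> label p r i \<noteq> label p s i)" if "p > 0" for p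
  proof (rule kuhn_lemma[of p p "label p"])
    show "\<forall>x. (\<forall>i<p. x i \<le> p) \<longrightarrow> (\<forall>i<p. x i = 0 \<longrightarrow> label p x i = 0)"
    proof (intro allI impI)
      fix x i assume "\<forall>i<p. x i \<le> p" "i < p" "x i = 0"
      then show "label p x i = 0"
        using fQ[OF vQ[of p x], of i] that by (auto simp: label_def v_def)
    qed
  next
    show "\<forall>x. (\<forall>i<p. x i \<le> p) \<longrightarrow> (\<forall>i<p. label p x i = 0 \<or> label p x i = 1)"
      "\<forall>x. (\<forall>i<p. x i \<le> p) \<longrightarrow> (\<forall>i<p. x i = p \<longrightarrow> label p x i = 1)"
      by (auto simp: label_def)
  qed (use that in blast)+
  then obtain q where q1: "\<And>p i. p > 0 \<Longrightarrow> i < p \<Longrightarrow> q p i < p"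
    and q2: "\<And>p i. p > 0 \<Longrightarrow> i < p \<Longrightarrow> \<exists>r s. (\<forall>j<p. q p j \<le> r j \<and> r j \<le> q p j + 1) \<and>
      (\<forall>j<p. q p j \<le> s j \<and> s j \<le> q p j + 1) \<and> label p r i \<noteq> label p s i"
    by metis
  define near where "near p z \<longleftrightarrow> (\<forall>j<p. q p j \<le> z j \<and> z j \<le> q p j + 1)" for p and z :: "nat \<Rightarrow> nat"
  have rs: "\<exists>r s. near p r \<and> near p s \<and> label p r i = 0 \<and> label p s i = 1" if "i < p" for p i
  proof -
    obtain r s where "near p r" "near p s" "label p r i \<noteq> label p s i"
      using q2[of p i] \<open>i < p\<close> by (auto simp: near_def)
    moreover have "label p z i = 0 \<or> label p z i = 1" for z
      by (simp add: label_def)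
    ultimately show ?thesis
      by metis
  qed
  \<comment> \<open>The vertices depend on i: Kuhn's lemma gives a separate pair for each
    coordinate, and nothing is known for i >= p.\<close>
  define r s where "r p i = (SOME z. near p z \<and> label p z i = 0)"
    and "s p i = (SOME z. near p z \<and> label p z i = 1)" for p i
  have r: "near p (r p i)" "label p (r p i) i = 0" and s: "near p (s p i)" "label p (s p i) i = 1"
    if "i < p" for p i
    using rs[OF that] someI_ex[of "\<lambda>z. near p z \<and> label p z i = 0"]
      someI_ex[of "\<lambda>z. near p z \<and> label p z i = 1"] unfolding r_def s_def by blast+
  \<comment> \<open>The index is shifted because the corner \<open>q p\<close> is specified only for
    p > 0.\<close>
  have "v (Suc p) (q (Suc p)) \<in> Q" for p
    using q1[of "Suc p"] by (intro vQ) (auto intro: less_imp_le)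
  moreover have "seq_compact Q"
    unfolding Q_def by (intro compact_imp_seq_compact compact_real_cube)
  ultimately obtain x \<sigma> where x: "x \<in> Q" and \<sigma>: "strict_mono \<sigma>"
    and "((\<lambda>p. v (Suc p) (q (Suc p))) \<circ> \<sigma>) \<longlonglongrightarrow> x"
    using seq_compactE[where f = "\<lambda>p. v (Suc p) (q (Suc p))"] by blast
  then have lim: "(\<lambda>k. v (Suc (\<sigma> k)) (q (Suc (\<sigma> k)))) \<longlonglongrightarrow> x"
    by (simp add: comp_def)
  define P where "P k = Suc (\<sigma> k)" for k
  have P_ev: "\<forall>\<^sub>F k in sequentially. j < P k" for j
    using \<sigma> filterlim_subseq[OF \<sigma>] unfolding P_def filterlim_at_top
    by (metis (mono_tags, lifting) eventually_mono le_imp_less_Suc)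
  have P_inv: "(\<lambda>k. 1 / real (P k)) \<longlonglongrightarrow> 0"
    using LIMSEQ_subseq_LIMSEQ[OF LIMSEQ_inverse_real_of_nat \<sigma>]
    by (simp add: P_def comp_def inverse_eq_divide)
  \<comment> \<open>Any vertex of the cell differs from its corner by at most 1/P in each
    coordinate, so all choices of vertices share the limit of the corners.\<close>
  have close: "(\<lambda>k. v (P k) (y k)) \<longlonglongrightarrow> x"
    if "\<And>k. i < P k \<Longrightarrow> near (P k) (y k)" for y i
  proof (rule tendsto_if_coordinates)
    fix j
    have "(\<lambda>k. v (P k) (q (P k)) j + (v (P k) (y k) j - v (P k) (q (P k)) j)) \<longlonglongrightarrow> x j + 0"
    proof (rule tendsto_add)
      show "(\<lambda>k. v (P k) (q (P k)) j) \<longlonglongrightarrow> x j"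
        using tendsto_coordinate[OF lim] by (simp add: P_def)
      show "(\<lambda>k. v (P k) (y k) j - v (P k) (q (P k)) j) \<longlonglongrightarrow> 0"
      proof (rule Lim_null_comparison[OF _ P_inv])
        show "\<forall>\<^sub>F k in sequentially. norm (v (P k) (y k) j - v (P k) (q (P k)) j) \<le> 1 / real (P k)"
          using P_ev[of i] P_ev[of j]
        proof eventually_elim
          case (elim k)
          have "\<bar>real (y k j) - real (q (P k) j)\<bar> \<le> 1"
            using that[OF elim(1)] elim(2) unfolding near_def by fastforce
          then show ?case
            using elim by (auto simp: v_def divide_right_mono simp flip: diff_divide_distrib)
        qed
      qed
    qed
    then show "(\<lambda>k. v (P k) (y k) j) \<longlonglongrightarrow> x j" by simp
  qed
  have fseq: "(\<lambda>k. f (X k)) \<longlonglongrightarrow> f x" if "X \<longlonglongrightarrow> x" "\<forall>\<^sub>F k in sequentially. X k \<in> Q" for X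
    using continuous_on_tendsto_compose[OF cont that(1) x that(2)] .
  have rs_Q: "\<forall>\<^sub>F k in sequentially. v (P k) (y k) \<in> Q"
    if "\<And>k. i < P k \<Longrightarrow> near (P k) (y k)" for y i
    using P_ev[of i]
  proof eventually_elim
    case (elim k)
    show ?case
    proof (intro vQ allI impI)
      fix j assume "j < P k"
      then show "y k j \<le> P k"
        using that[OF elim] q1[of "P k" j] unfolding near_def by fastforce
    qed
  qed
  have "f x i = x i" for i
  proof (rule antisym)
    let ?r = "\<lambda>k. v (P k) (r (P k) i)" and ?s = "\<lambda>k. v (P k) (s (P k) i)"
    have R: "?r \<longlonglongrightarrow> x" and S: "?s \<longlonglongrightarrow> x"
      by (rule close[of i], erule r(1), rule close[of i], erule s(1))
    have QR: "\<forall>\<^sub>F k in sequentially. ?r k \<in> Q" and QS: "\<forall>\<^sub>F k in sequentially. ?s k \<in> Q"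
      by (rule rs_Q[of i], erule r(1), rule rs_Q[of i], erule s(1))
    note fR = fseq[OF R QR] and fS = fseq[OF S QS]
    show "x i \<le> f x i"
    proof (rule tendsto_le[OF _ tendsto_coordinate[OF fR, of i] tendsto_coordinate[OF R, of i]])
      show "\<forall>\<^sub>F k in sequentially. ?r k i \<le> f (?r k) i"
        using P_ev[of i]
      proof eventually_elim
        case (elim k)
        show ?case
          using r(2)[OF elim] by (auto simp: label_def split: if_splits)
      qed
    qed simp
    show "f x i \<le> x i"
    proof (rule tendsto_le[OF _ tendsto_coordinate[OF S, of i] tendsto_coordinate[OF fS, of i]])
      show "\<forall>\<^sub>F k in sequentially. f (?s k) i \<le> ?s k i"
        using P_ev[of i] QS
      proof eventually_elim
        case (elim k)
        \<comment> \<open>Where label 1 was only forced by the upper face, the coordinate equals 1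
          and still bounds f from above.\<close>
        have "?s k i = 1" if "s (P k) i i = P k"
          using that elim by (simp add: v_def)
        then show ?case
          using s(2)[OF elim(1)] fQ[OF elim(2), of i] by (auto simp: label_def split: if_splits)
      qed
    qed simp
  qed
  then show ?thesis
    by (intro that[OF x] ext)
qed

text \<open>The values of F at N nodes of a period give a self-map of the cube, whose fixed point is
  an approximate fixed point of F with error at most 2LT/N. The common Lipschitz constant of all F y
  also provides the equicontinuity for Arzela-Ascoli, so continuity of F under pointwise convergence
  is enough to pass to the limit.\<close>

lemma periodic_schauder:
  fixes F :: "(real \<Rightarrow> real) \<Rightarrow> real \<Rightarrow> real"
    and T R L :: real
  defines "X \<equiv> {y. continuous_on UNIV y \<and> periodic_fun_simple y T \<and> (\<forall>t. \<bar>y t\<bar> \<le> R)}"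
  assumes T: "0 < T" and R: "0 < R" and L: "0 \<le> L"
    and maps: "\<And>y. y \<in> X \<Longrightarrow> F y \<in> X"
    and lip: "\<And>y s t. y \<in> X \<Longrightarrow> \<bar>F y s - F y t\<bar> \<le> L * \<bar>s - t\<bar>"
    and cont: "\<And>Y y t. (\<And>n. Y n \<in> X) \<Longrightarrow> y \<in> X \<Longrightarrow> (\<And>s. (\<lambda>n. Y n s) \<longlonglongrightarrow> y s) \<Longrightarrow>
      (\<lambda>n::nat. F (Y n) t) \<longlonglongrightarrow> F y t"
  obtains y where "y \<in> X" "F y = y"
proof -
  define Q where "Q = {x :: nat \<Rightarrow> real. \<forall>i. x i \<in> {0..1}}"
  \<comment> \<open>\<open>D\<close> is the distance to the lattice \<open>T\<int>\<close>; \<open>w N i / W N\<close> is a periodic partition of unity and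
    \<open>p N x\<close> interpolates the values \<open>x\<close>, rescaled to \<open>[-R, R]\<close>.\<close>
  define D where "D s = infdist s (range (\<lambda>j. T * of_int j))" for s
  define w where "w N i t = max 0 (2 * T / real N - D (t - T * real i / real N))" for N i :: nat and t
  define W where "W N t = (\<Sum>i<N. w N i t)" for N t
  define p where "p N x t = (\<Sum>i<N. w N i t * (R * (2 * x i - 1))) / W N t"
    for N and x :: "nat \<Rightarrow> real" and t
  have XD: "continuous_on UNIV y" "\<bar>y t\<bar> \<le> R" "y (t + T) = y t" "y (t + of_int j * T) = y t"
    if "y \<in> X" for y t j
  proof -
    interpret periodic_fun_simple y T using that by (simp add: X_def)
    show "continuous_on UNIV y" "\<bar>y t\<bar> \<le> R" "y (t + T) = y t" "y (t + of_int j * T) = y t"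
      using that plus_of_int[of t j] plus_period by (auto simp: X_def)
  qed
  have D_le: "D s \<le> \<bar>s - T * of_int j\<bar>" for s j
    using infdist_le[of "T * of_int j" "range (\<lambda>j. T * of_int j)" s] by (auto simp: D_def dist_real_def)
  have D_less: "\<exists>j. \<bar>s - T * of_int j\<bar> < e" if "D s < e" for s e
  proof -
    have "(INF a\<in>range (\<lambda>j. T * of_int j). dist s a) < e"
      using that by (simp add: D_def infdist_notempty)
    then show ?thesis
      by (subst (asm) cINF_less_iff) (auto simp: dist_real_def intro!: bdd_belowI[of _ 0])
  qed
  have D_period: "D (s + T) = D s" for s
  proof (rule antisym; rule field_le_epsilon)
    fix e :: real assume "0 < e"
    then obtain j where "\<bar>s - T * of_int j\<bar> < D s + e"
      using D_less[of s "D s + e"] by auto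
    then show "D (s + T) \<le> D s + e"
      using D_le[of "s + T" "j + 1"] by (simp add: algebra_simps)
    obtain j where "\<bar>s + T - T * of_int j\<bar> < D (s + T) + e"
      using D_less[of "s + T" "D (s + T) + e"] \<open>0 < e\<close> by auto
    then show "D s \<le> D (s + T) + e"
      using D_le[of s "j - 1"] by (simp add: algebra_simps)
  qed
  have w_nonneg: "0 \<le> w N i t" for N i t
    by (simp add: w_def)
  have W_pos: "0 < W N t" if "0 < N" for N t
  proof -
    \<comment> \<open>zT/N is the last node to the left of t, at distance at most T/N. Reducing z
      modulo N moves it by whole periods, which D ignores. The hats have half-width 2T/N, so the hat
      of this node is positive at t.\<close>
    define z where "z = \<lfloor>N * t / T\<rfloor>"
    define i where "i = nat (z mod int N)"
    have "z = int N * (z div int N) + int i"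
      using that by (simp add: i_def)
    then have "real_of_int z = real_of_int (int N * (z div int N) + int i)"
      by (rule arg_cong)
    then have i: "of_int z = real N * of_int (z div int N) + real i"
      by simp
    have iN: "i < N"
      using that by (simp add: i_def nat_less_iff)
    have "of_int z \<le> N * t / T" "N * t / T < of_int z + 1"
      unfolding z_def by linarith+
    then have "of_int z * T \<le> N * t" "N * t < of_int z * T + T"
      using T by (simp_all add: field_simps)
    then have "\<bar>N * t - of_int z * T\<bar> / N \<le> T / N"
      by (intro divide_right_mono) auto
    also have "\<bar>N * t - of_int z * T\<bar> / N = \<bar>(N * t - of_int z * T) / N\<bar>"
      by simp
    also have "(N * t - of_int z * T) / N = t - T * real i / N - T * of_int (z div int N)"
      unfolding i using that by (simp add: field_simps)
    finally have "D (t - T * real i / N) \<le> T / N"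
      using D_le order_trans by blast
    then have "0 < w N i t"
      using divide_strict_right_mono[of T "2 * T" "real N"] T that by (simp add: w_def)
    then show ?thesis
      unfolding W_def using iN w_nonneg by (intro sum_pos2[of _ i]) auto
  qed
  have pX: "p N x \<in> X" if N: "0 < N" and x: "x \<in> Q" for N x
  proof -
    have "continuous_on UNIV (p N x)"
      unfolding p_def W_def w_def D_def
      by (intro continuous_intros ballI) (use W_pos[OF N] in \<open>auto simp: W_def w_def D_def less_le\<close>)
    moreover have "periodic_fun_simple (p N x) T"
    proof
      have "w N i (t + T) = w N i t" for i t
        using D_period[of "t - T * real i / real N"] by (simp add: w_def algebra_simps)
      then show "p N x (t + T) = p N x t" for t
        by (simp add: p_def W_def)
    qed
    moreover have "\<bar>p N x t\<bar> \<le> R" for t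
    proof -
      have "\<bar>\<Sum>i<N. w N i t * (R * (2 * x i - 1))\<bar> \<le> (\<Sum>i<N. w N i t * R)"
      proof (rule order_trans[OF sum_abs sum_mono])
        fix i
        have "\<bar>2 * x i - 1\<bar> \<le> 1"
          using x by (auto simp: Q_def abs_le_iff)
        then have "R * \<bar>2 * x i - 1\<bar> \<le> R"
          using R by (simp add: mult_le_cancel_left1)
        then show "\<bar>w N i t * (R * (2 * x i - 1))\<bar> \<le> w N i t * R"
          using w_nonneg[of N i t] R by (auto simp: abs_mult intro: mult_left_mono)
      qed
      then show ?thesis
        using W_pos[OF N, of t] by (simp add: p_def W_def divide_simps abs_mult sum_distrib_left mult.commute)
    qed
    ultimately show ?thesis by (simp add: X_def)
  qed
  have approx: "\<exists>y\<in>X. \<forall>t. \<bar>y t - F y t\<bar> \<le> L * (2 * T / N)" if N: "0 < N" for N :: nat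
  proof -
    \<comment> \<open>The samples are rescaled from [-R, R] to [0, 1]; the coordinates from N on
      carry no data and are set to 0.\<close>
    define f where "f x i = (if i < N then (F (p N x) (T * real i / N) + R) / (2 * R) else 0)" for x i
    have "continuous_on Q f"
    proof (rule continuous_on_coordinatewise_then_product)
      fix i
      have "(\<lambda>k. f (x k) i) \<longlonglongrightarrow> f a i" if a: "a \<in> Q" "\<And>k. x k \<in> Q" "x \<longlonglongrightarrow> a" for x a
      proof -
        have "(\<lambda>k. p N (x k) t) \<longlonglongrightarrow> p N a t" for t
          unfolding p_def using W_pos[OF N, of t]
          by (intro tendsto_intros tendsto_coordinate[OF a(3)]) auto
        then have "(\<lambda>k. F (p N (x k)) t) \<longlonglongrightarrow> F (p N a) t" for t
          using a pX[OF N] by (intro cont) auto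
        then show ?thesis
          using R unfolding f_def by (auto intro!: tendsto_intros)
      qed
      then show "continuous_on Q (\<lambda>x. f x i)"
        by (auto simp: continuous_on_sequentially comp_def)
    qed
    moreover have "f ` Q \<subseteq> Q"
    proof clarify
      fix x assume "x \<in> Q"
      then have "\<bar>F (p N x) t\<bar> \<le> R" for t
        using XD(2) maps pX[OF N] by blast
      then show "f x \<in> Q"
        using R by (auto simp: Q_def f_def divide_simps abs_le_iff) (smt (verit))+
    qed
    ultimately obtain x where x: "x \<in> Q" "f x = x"
      unfolding Q_def by (rule hilbert_cube_fixed_point)
    define y where "y = p N x"
    have yX: "y \<in> X"
      using pX[OF N x(1)] by (simp add: y_def)
    \<comment> \<open>Being a fixed point means that y interpolates exactly the values of F y at the
      nodes. So y t is an average of values of F y at points which, modulo T, lie within 2T/N of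
      t.\<close>
    have node: "R * (2 * x i - 1) = F y (T * real i / N)" if "i < N" for i
      using fun_cong[OF x(2), of i] that R by (simp add: f_def y_def field_simps)
    have "\<bar>y t - F y t\<bar> \<le> L * (2 * T / N)" for t
    proof -
      have "y t * W N t = (\<Sum>i<N. w N i t * F y (T * real i / N))"
        using W_pos[OF N, of t] by (simp add: y_def p_def node[unfolded y_def])
      then have "(y t - F y t) * W N t = (\<Sum>i<N. w N i t * (F y (T * real i / N) - F y t))"
        by (simp add: left_diff_distrib right_diff_distrib sum_subtractf W_def sum_distrib_left mult.commute)
      moreover have "\<bar>\<Sum>i<N. w N i t * (F y (T * real i / N) - F y t)\<bar> \<le> (\<Sum>i<N. w N i t * (L * (2 * T / N)))"
      proof (rule order_trans[OF sum_abs sum_mono])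
        fix i
        show "\<bar>w N i t * (F y (T * real i / N) - F y t)\<bar> \<le> w N i t * (L * (2 * T / N))"
        proof (cases "w N i t = 0")
          case False
          then have "D (t - T * real i / N) < 2 * T / N"
            by (auto simp: w_def max_def split: if_splits)
          then obtain j where j: "\<bar>t - T * real i / N - T * of_int j\<bar> < 2 * T / N"
            using D_less by blast
          have "\<bar>F y (T * real i / N) - F y t\<bar> = \<bar>F y (T * real i / N + of_int j * T) - F y t\<bar>"
            using XD(4)[OF maps[OF yX]] by simp
          also have "\<dots> \<le> L * \<bar>T * real i / N + of_int j * T - t\<bar>"
            by (rule lip[OF yX])
          also have "\<dots> \<le> L * (2 * T / N)"
            using j L by (intro mult_left_mono) (auto simp: abs_if algebra_simps split: if_splits)
          finally show ?thesis
            unfolding abs_mult abs_of_nonneg[OF w_nonneg] by (rule mult_left_mono[OF _ w_nonneg])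
        qed simp
      qed
      ultimately have "\<bar>(y t - F y t) * W N t\<bar> \<le> L * (2 * T / N) * W N t"
        unfolding W_def sum_distrib_right[symmetric] by (simp only: mult.commute)
      then have "\<bar>y t - F y t\<bar> * W N t \<le> L * (2 * T / N) * W N t"
        using W_pos[OF N, of t] by (simp add: abs_mult)
      then show ?thesis
        using W_pos[OF N, of t] mult_le_cancel_right_pos by blast
    qed
    then show ?thesis using yX by blast
  qed
  have "\<exists>y\<in>X. \<forall>t. \<bar>y t - F y t\<bar> \<le> L * (2 * T / Suc n)" for n
    by (rule approx) simp
  then obtain Y where Y: "\<And>n. Y n \<in> X" "\<And>n t. \<bar>Y n t - F (Y n) t\<bar> \<le> L * (2 * T / Suc n)"
    by metis
  obtain g k where k: "strict_mono (k :: nat \<Rightarrow> nat)"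
    and g: "\<And>e. 0 < e \<Longrightarrow> \<exists>N. \<forall>n x. n \<ge> N \<and> x \<in> {0..T} \<longrightarrow> norm (F (Y (k n)) x - g x) < e"
  proof (rule Arzela_Ascoli[of "{0..T}" "\<lambda>n. F (Y n)" R])
    show "norm (F (Y n) x) \<le> R" for n x
      using XD(2)[OF maps[OF Y(1)]] by simp
    show "\<exists>d>0. \<forall>n y. y \<in> {0..T} \<and> norm (x - y) < d \<longrightarrow> norm (F (Y n) x - F (Y n) y) < e"
      if "0 < e" for x e
    proof (intro exI conjI allI impI)
      show "0 < e / (L + 1)" using that L by simp
      fix n y assume "y \<in> {0..T} \<and> norm (x - y) < e / (L + 1)"
      then have "(L + 1) * \<bar>x - y\<bar> < e"
        using L by (simp add: field_simps)
      then show "norm (F (Y n) x - F (Y n) y) < e"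
        using lip[OF Y(1), of n x y] by (simp add: algebra_simps)
    qed
  qed auto
  \<comment> \<open>Arzela-Ascoli controls g on {0..T} only, so the limit is extended from there by
    periodicity.\<close>
  define y where "y t = g (t - of_int \<lfloor>t / T\<rfloor> * T)" for t
  have Z: "(\<lambda>n. F (Y (k n)) t) \<longlonglongrightarrow> y t" for t
  proof -
    define s where "s = t - of_int \<lfloor>t / T\<rfloor> * T"
    have s: "s \<in> {0..T}"
      using floor_divide_lower[OF T, of t] floor_divide_upper[OF T, of t] by (simp add: s_def algebra_simps)
    have "(\<lambda>n. F (Y (k n)) s) \<longlonglongrightarrow> g s"
      unfolding LIMSEQ_def dist_norm using g s by blast
    moreover have "F (Y (k n)) t = F (Y (k n)) s" for n
      using XD(4)[OF maps[OF Y(1)], of "k n" s "\<lfloor>t / T\<rfloor>"] by (simp add: s_def)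
    ultimately show ?thesis
      by (simp add: y_def s_def)
  qed
  have ylip: "\<bar>y s - y t\<bar> \<le> L * \<bar>s - t\<bar>" for s t
    by (rule tendsto_upperbound[OF tendsto_rabs[OF tendsto_diff[OF Z Z]]])
      (intro always_eventually allI lip Y, simp)
  have yX: "y \<in> X"
    unfolding X_def
  proof (intro CollectI conjI allI)
    show "continuous_on UNIV y"
      using ylip L by (intro lipschitz_on_continuous_on[of L] lipschitz_onI) (auto simp: dist_real_def)
    show "periodic_fun_simple y T"
    proof
      fix t
      have "(\<lambda>n. F (Y (k n)) (t + T)) \<longlonglongrightarrow> y t"
        using Z[of t] XD(3)[OF maps[OF Y(1)]] by simp
      then show "y (t + T) = y t"
        using Z LIMSEQ_unique by blast
    qed
    show "\<bar>y t\<bar> \<le> R" for t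
      by (rule tendsto_upperbound[OF tendsto_rabs[OF Z]])
        (intro always_eventually allI XD(2)[OF maps[OF Y(1)]], simp)
  qed
  \<comment> \<open>The approximate fixed points share the limit of their images, since the error
    tends to 0. Now \<open>cont\<close> applies to them.\<close>
  have "(\<lambda>n. Y (k n) t) \<longlonglongrightarrow> y t" for t
  proof -
    have "(\<lambda>n. L * (2 * T * inverse (real (Suc (k n))))) \<longlonglongrightarrow> L * (2 * T * 0)"
      using LIMSEQ_subseq_LIMSEQ[OF LIMSEQ_inverse_real_of_nat k]
      by (intro tendsto_intros) (simp add: comp_def)
    then have lim0: "(\<lambda>n. L * (2 * T / Suc (k n))) \<longlonglongrightarrow> 0"
      by (simp add: divide_inverse)
    have "(\<lambda>n. Y (k n) t - F (Y (k n)) t) \<longlonglongrightarrow> 0"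
    proof (rule Lim_null_comparison[OF _ lim0], intro always_eventually allI)
      show "norm (Y (k n) t - F (Y (k n)) t) \<le> L * (2 * T / Suc (k n))" for n
        unfolding real_norm_def by (rule Y(2))
    qed
    from tendsto_add[OF this Z[of t]] show ?thesis by simp
  qed
  then have "(\<lambda>n. F (Y (k n)) t) \<longlonglongrightarrow> F y t" for t
    using Y(1) yX by (intro cont) auto
  then have "F y = y"
    using Z LIMSEQ_unique by blast
  then show ?thesis
    using that yX by blast
qed

section \<open>Periodic solutions of linear equations\<close>

lemma continuous_antiderivative:
  fixes f :: "real \<Rightarrow> real"
  assumes "continuous_on UNIV f"
  obtains G where "\<And>s. (G has_real_derivative f s) (at s)"
proof
  fix s :: real
  \<comment> \<open>The interval is chosen to contain both 0 and s in its interior. The integral is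
    signed, so negative s are covered.\<close>
  have "((\<lambda>u. LBINT y=ereal 0..ereal u. f y) has_vector_derivative f s) (at s within {- (\<bar>s\<bar> + 1)..\<bar>s\<bar> + 1})"
    by (rule interval_integral_FTC2) (auto intro: continuous_on_subset[OF assms])
  moreover have "at s within {- (\<bar>s\<bar> + 1)..\<bar>s\<bar> + 1} = at s"
    by (rule at_within_Icc_at) auto
  ultimately show "((\<lambda>u. LBINT y=ereal 0..ereal u. f y) has_real_derivative f s) (at s)"
    by (simp add: has_real_derivative_iff_has_vector_derivative)
qed

lemma continuous_periodic_attains_sup:
  fixes f :: "real \<Rightarrow> real"
  assumes "continuous_on UNIV f" "periodic_fun_simple f T" "0 < T"
  obtains s where "\<And>t. f t \<le> f s"
proof -
  interpret periodic_fun_simple f T by fact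
  have "continuous_on {0..T} f"
    using assms(1) continuous_on_subset by blast
  then obtain s where s: "\<forall>t\<in>{0..T}. f t \<le> f s"
    using continuous_attains_sup[of "{0..T}" f] \<open>0 < T\<close> by auto
  show thesis
  proof
    fix t
    have "t - of_int \<lfloor>t / T\<rfloor> * T \<in> {0..T}"
      using floor_divide_lower[OF \<open>0 < T\<close>, of t] floor_divide_upper[OF \<open>0 < T\<close>, of t]
      by (simp add: algebra_simps)
    then show "f t \<le> f s"
      using s minus_of_int[of t "\<lfloor>t / T\<rfloor>"] by metis
  qed
qed

lemma periodic_fun_simple_uminus:
  fixes f :: "'a::ring_1 \<Rightarrow> 'b::group_add"
  shows "periodic_fun_simple f T \<Longrightarrow> periodic_fun_simple (\<lambda>t. - f t) T"
  by (simp add: periodic_fun_simple_def)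

lemma continuous_periodic_attains_inf:
  fixes f :: "real \<Rightarrow> real"
  assumes "continuous_on UNIV f" "periodic_fun_simple f T" "0 < T"
  obtains s where "\<And>t. f s \<le> f t"
  using continuous_periodic_attains_sup[of "\<lambda>t. - f t" T] assms
  by (metis continuous_on_minus neg_le_iff_le periodic_fun_simple_uminus)

text \<open>The \<open>T\<close>-periodic solution of \<open>z' = g - a z\<close>, for either sign of \<open>a\<close>.\<close>

definition green :: "real \<Rightarrow> real \<Rightarrow> (real \<Rightarrow> real) \<Rightarrow> real \<Rightarrow> real" where
  "green T a g t = integral {0..T} (\<lambda>u. exp (a * u) * g (t + u)) / (exp (a * T) - 1)"

text \<open>With G an antiderivative of exp(a s) g(s), the integral becomes exp(-a t) (G(t+T) -
  G(t)), which is differentiated by the product rule instead of under the integral sign. Periodicity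
  of g then cancels the factor exp(a T) - 1.\<close>

lemma green_has_derivative:
  assumes "0 < T" "a \<noteq> 0" and g: "continuous_on UNIV g" "periodic_fun_simple g T"
  shows "(green T a g has_real_derivative g t - a * green T a g t) (at t)"
proof -
  have "continuous_on UNIV (\<lambda>s. exp (a * s) * g s)"
    by (intro continuous_intros g)
  then obtain G where G: "\<And>s. (G has_real_derivative exp (a * s) * g s) (at s)"
    using continuous_antiderivative by blast
  have eq: "green T a g t = exp (- (a * t)) * (G (t + T) - G t) / (exp (a * T) - 1)" for t
  proof -
    have "((\<lambda>u. exp (a * u) * g (t + u)) has_integral exp (- (a * t)) * G (t + T) - exp (- (a * t)) * G (t + 0)) {0..T}"
    proof (rule fundamental_theorem_of_calculus)
      fix u
      have "((\<lambda>u. exp (- (a * t)) * G (t + u)) has_real_derivative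
          exp (- (a * t)) * (exp (a * (t + u)) * g (t + u) * 1)) (at u)"
        by (intro DERIV_cmult DERIV_chain2[OF G]) (auto intro!: derivative_eq_intros)
      also have "exp (- (a * t)) * (exp (a * (t + u)) * g (t + u) * 1) = exp (a * u) * g (t + u)"
        by (simp add: algebra_simps exp_add exp_minus)
      finally show "((\<lambda>u. exp (- (a * t)) * G (t + u)) has_vector_derivative exp (a * u) * g (t + u))
          (at u within {0..T})"
        by (simp add: has_real_derivative_iff_has_vector_derivative has_vector_derivative_at_within)
    qed (use assms in simp)
    then show ?thesis
      by (simp add: green_def integral_unique right_diff_distrib)
  qed
  have nz: "exp (a * T) - 1 \<noteq> 0"
    using assms by simp
  have G': "((\<lambda>t. G (t + T)) has_real_derivative exp (a * (t + T)) * g (t + T) * 1) (at t)"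
    by (rule DERIV_chain2[OF G]) (auto intro!: derivative_eq_intros)
  have "g (t + T) = g t"
    by (rule periodic_fun_simple.plus_period[OF g(2)])
  then have "exp (- (a * t)) * (exp (a * (t + T)) * g (t + T) * 1 - exp (a * t) * g t) / (exp (a * T) - 1) = g t"
    using nz by (simp add: algebra_simps exp_add exp_minus) (simp add: divide_simps algebra_simps)
  moreover have "((\<lambda>t. exp (- (a * t)) * (G (t + T) - G t) / (exp (a * T) - 1)) has_real_derivative
      (- a * exp (- (a * t)) * (G (t + T) - G t) +
        (exp (a * (t + T)) * g (t + T) * 1 - exp (a * t) * g t) * exp (- (a * t))) / (exp (a * T) - 1)) (at t)"
    by (intro DERIV_cdivide DERIV_mult DERIV_diff G G') (auto intro!: derivative_eq_intros)
  ultimately show ?thesis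
    unfolding eq by (simp add: add_divide_distrib diff_divide_distrib mult.commute mult.left_commute)
qed

lemma green_periodic:
  assumes "periodic_fun_simple g T"
  shows "periodic_fun_simple (green T a g) T"
proof
  fix t
  have "g (t + T + u) = g (t + u)" for u
    using periodic_fun_simple.plus_period[OF assms, of "t + u"] by (simp add: add_ac)
  then show "green T a g (t + T) = green T a g t"
    by (simp add: green_def)
qed

lemma green_bound:
  assumes "0 < T" and g: "continuous_on UNIV g" "\<And>t. \<bar>g t\<bar> \<le> K"
  shows "\<bar>green T a g t\<bar> \<le> exp (\<bar>a\<bar> * T) * K * T / \<bar>exp (a * T) - 1\<bar>"
proof -
  have "norm (integral {0..T} (\<lambda>u. exp (a * u) * g (t + u))) \<le> exp (\<bar>a\<bar> * T) * K * (T - 0)"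
  proof (rule integral_bound)
    show "continuous_on {0..T} (\<lambda>u. exp (a * u) * g (t + u))"
      by (intro continuous_intros continuous_on_compose2[OF g(1)]) auto
    fix u assume u: "u \<in> {0..T}"
    have "a * u \<le> \<bar>a\<bar> * T"
      using u by (intro mult_mono) auto
    then have "exp (a * u) * \<bar>g (t + u)\<bar> \<le> exp (\<bar>a\<bar> * T) * K"
      using g(2) by (intro mult_mono) auto
    then show "norm (exp (a * u) * g (t + u)) \<le> exp (\<bar>a\<bar> * T) * K"
      by (simp add: abs_mult)
  qed (use assms in auto)
  then show ?thesis
    by (simp add: green_def divide_right_mono)
qed

text \<open>Provides the continuity that \<open>periodic_schauder\<close> asks for: under the
  uniform bound K, pointwise convergence suffices by dominated convergence.\<close>

lemma green_tendsto:
  assumes g: "\<And>n. continuous_on UNIV (g n)" "\<And>n t. \<bar>g n t\<bar> \<le> K"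
    and lim: "\<And>t. (\<lambda>n. g n t) \<longlonglongrightarrow> h t"
  shows "(\<lambda>n. green T a (g n) t) \<longlonglongrightarrow> green T a h t"
proof -
  have "(\<lambda>n. integral {0..T} (\<lambda>u. exp (a * u) * g n (t + u))) \<longlonglongrightarrow>
      integral {0..T} (\<lambda>u. exp (a * u) * h (t + u))"
  proof (rule dominated_convergence(2))
    show "(\<lambda>u. exp (a * u) * g n (t + u)) integrable_on {0..T}" for n
      by (intro integrable_continuous_real continuous_intros continuous_on_compose2[OF g(1)]) auto
    show "(\<lambda>u. exp (a * u) * K) integrable_on {0..T}"
      by (intro integrable_continuous_real continuous_intros)
    show "norm (exp (a * u) * g n (t + u)) \<le> exp (a * u) * K" for n u
      using g(2) by (simp add: abs_mult)
    show "(\<lambda>n. exp (a * u) * g n (t + u)) \<longlonglongrightarrow> exp (a * u) * h (t + u)" for u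
      by (intro tendsto_intros lim)
  qed
  then show ?thesis
    unfolding green_def divide_inverse by (intro tendsto_intros)
qed

section \<open>Solutions in a band\<close>

lemma tendsto_exp_mult_at_top: "((\<lambda>x::real. exp (c * x)) \<longlongrightarrow> 0) at_top" if "c < 0"
  by (rule filterlim_compose[OF exp_at_bot])
    (use that in \<open>intro filterlim_tendsto_neg_mult_at_bot[OF tendsto_const _ filterlim_ident]\<close>)

lemma tendsto_exp_mult_at_bot: "((\<lambda>x::real. exp (c * x)) \<longlongrightarrow> 0) at_bot" if "0 < c"
  using tendsto_exp_mult_at_top[of "- c"] that by (simp add: filterlim_at_bot_mirror)

lemma has_at_least_2: "a \<in> A \<Longrightarrow> b \<in> A \<Longrightarrow> a \<noteq> b \<Longrightarrow> has_at_least 2 A"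
  unfolding has_at_least_def by (intro exI[of _ "{a, b}"]) auto

lemma has_at_least_3:
  "a \<in> A \<Longrightarrow> b \<in> A \<Longrightarrow> c \<in> A \<Longrightarrow> a \<noteq> b \<Longrightarrow> b \<noteq> c \<Longrightarrow> a \<noteq> c \<Longrightarrow> has_at_least 3 A"
  unfolding has_at_least_def by (intro exI[of _ "{a, b, c}"]) auto

section \<open>The delay equation in logarithmic form\<close>

locale delay_equation =
  fixes T :: real and M :: nat
    and lam m n :: "nat \<Rightarrow> real"
    and r \<tau> \<mu> :: "nat \<Rightarrow> real \<Rightarrow> real"
    and b :: "real \<Rightarrow> real"
  assumes T_pos: "0 < T"
    and params: "\<And>k. k \<in> {1..M} \<Longrightarrow> 0 < lam k \<and> 0 < m k \<and> 0 < n k"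
    and coeffs: "\<And>k. k \<in> {1..M} \<Longrightarrow> continuous_positive_periodic T (r k)
      \<and> continuous_positive_periodic T (\<tau> k) \<and> continuous_positive_periodic T (\<mu> k)"
    and decay: "continuous_positive_periodic T b"
begin

abbreviation C :: real where "C \<equiv> total_decay T b"

text \<open>The right-hand side of the equation for \<open>y = ln x\<close>: \<open>c\<close> is the present value of \<open>y\<close> and
  \<open>u k\<close>, \<open>v k\<close> are the two delayed ones.\<close>

definition log_rhs :: "real \<Rightarrow> real \<Rightarrow> (nat \<Rightarrow> real) \<Rightarrow> (nat \<Rightarrow> real) \<Rightarrow> real" where
  "log_rhs t c u v =
     (\<Sum>k = 1..M. lam k * r k t * (exp (m k * u k - c) / (1 + exp (n k * v k)))) - b t"

lemma decay_facts: "continuous_on UNIV b" "0 < b t" "periodic_fun_simple b T"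
  using decay by (auto simp: continuous_positive_periodic_def)

lemma coeff_facts:
  assumes "k \<in> {1..M}"
  shows "continuous_on UNIV (r k)" "0 < r k t" "periodic_fun_simple (r k) T"
    "continuous_on UNIV (\<tau> k)" "periodic_fun_simple (\<tau> k) T"
    "continuous_on UNIV (\<mu> k)" "periodic_fun_simple (\<mu> k) T"
  using coeffs[OF assms] by (auto simp: continuous_positive_periodic_def)

lemma C_nonneg: "0 \<le> C"
  unfolding total_decay_def
  by (intro integral_nonneg integrable_continuous_real continuous_on_subset[OF decay_facts(1)])
    (auto intro: less_imp_le[OF decay_facts(2)])

lemma coeff_upper_bounds:
  obtains \<rho> B where "\<And>k t. k \<in> {1..M} \<Longrightarrow> r k t \<le> \<rho> k" "\<And>k. k \<in> {1..M} \<Longrightarrow> 0 < \<rho> k"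
    "\<And>t. b t \<le> B" "0 < B"
proof -
  have "\<exists>s. \<forall>t. r k t \<le> r k s" if "k \<in> {1..M}" for k
    using continuous_periodic_attains_sup[OF coeff_facts(1,3)[OF that] T_pos] by blast
  then obtain s where "\<And>k t. k \<in> {1..M} \<Longrightarrow> r k t \<le> r k (s k)"
    by metis
  moreover obtain s' where "\<And>t. b t \<le> b s'"
    using continuous_periodic_attains_sup[OF decay_facts(1,3) T_pos] by blast
  ultimately show thesis
    using that[of "\<lambda>k. r k (s k)" "b s'"] coeff_facts(2) decay_facts(2) by blast
qed

text \<open>With \<open>-b\<close> as a lower bound for \<open>y'\<close>, a periodic \<open>y\<close> cannot descend by more than \<open>C\<close> in one
  period.\<close>

lemma oscillation_le_C:
  assumes y: "periodic_fun_simple y T" "\<And>t. (y has_real_derivative y' t) (at t)" "\<And>t. - b t \<le> y' t"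
  shows "\<bar>y s - y t\<bar> \<le> C"
proof -
  interpret y: periodic_fun_simple y T by fact
  obtain Bf where Bf: "\<And>s. (Bf has_real_derivative b s) (at s)"
    using continuous_antiderivative[OF decay_facts(1)] by blast
  have Bf_mono: "Bf s \<le> Bf t" if "s \<le> t" for s t
    by (rule DERIV_nonneg_imp_nondecreasing[OF that]) (use Bf decay_facts(2) in \<open>blast intro: less_imp_le\<close>)
  \<comment> \<open>By periodicity of b the increment of \<open>Bf\<close> is C over every interval
    of length T, not only over {0..T}.\<close>
  have "((\<lambda>t. Bf (t + T) - Bf t) has_real_derivative b (t + T) * 1 - b t) (at t)" for t
    by (intro DERIV_diff Bf DERIV_chain2[OF Bf]) (auto intro!: derivative_eq_intros)
  then have "((\<lambda>t. Bf (t + T) - Bf t) has_real_derivative 0) (at t)" for t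
    using periodic_fun_simple.plus_period[OF decay_facts(3)] by simp
  then have "Bf (t + T) - Bf t = Bf (0 + T) - Bf 0" for t
    by (rule DERIV_isconst_all[rule_format])
  moreover have "(b has_integral Bf T - Bf 0) {0..T}"
    by (rule fundamental_theorem_of_calculus)
      (use T_pos Bf in \<open>auto simp: has_real_derivative_iff_has_vector_derivative has_vector_derivative_at_within\<close>)
  ultimately have Bf_period: "Bf (t + T) - Bf t = C" for t
    by (simp add: total_decay_def integral_unique)
  have "y t - y s \<le> C" for s t
  proof -
    \<comment> \<open>Shifting s by whole periods puts it into [t, t+T]. There y + \<open>Bf\<close>
      is nondecreasing, so y descends by at most the increment of \<open>Bf\<close>.\<close>
    define s' where "s' = s - of_int \<lfloor>(s - t) / T\<rfloor> * T"
    have s': "t \<le> s'" "s' \<le> t + T"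
      using floor_divide_lower[OF T_pos, of "s - t"] floor_divide_upper[OF T_pos, of "s - t"]
      by (simp_all add: s'_def algebra_simps)
    have "y t + Bf t \<le> y s' + Bf s'"
    proof (rule DERIV_nonneg_imp_nondecreasing[OF s'(1)])
      fix x
      have "((\<lambda>x. y x + Bf x) has_real_derivative y' x + b x) (at x)"
        by (intro DERIV_add y Bf)
      moreover have "0 \<le> y' x + b x"
        using y(3)[of x] by simp
      ultimately show "\<exists>d. ((\<lambda>x. y x + Bf x) has_real_derivative d) (at x) \<and> 0 \<le> d"
        by blast
    qed
    moreover have "y s' = y s"
      unfolding s'_def by (rule y.minus_of_int)
    ultimately show ?thesis
      using Bf_mono[OF s'(2)] Bf_period[of t] by linarith
  qed
  from this[of s t] this[of t s] show ?thesis by linarith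
qed

text \<open>\<open>log_rhs\<close> increases in u and decreases in v, so its extremes lie at
  opposite ends of the two intervals: \<alpha> is its value at u = \<gamma> - C, v = \<gamma> + C,
  and \<beta> its value at u = \<gamma> + C, v = \<gamma> - C.\<close>

lemma alpha_le_log_rhs_le_beta:
  assumes "\<And>k. u k \<in> {\<gamma> - C..\<gamma> + C}" "\<And>k. v k \<in> {\<gamma> - C..\<gamma> + C}"
  shows "alpha T M lam m n r b \<gamma> t \<le> log_rhs t \<gamma> u v" "log_rhs t \<gamma> u v \<le> beta T M lam m n r b \<gamma> t"
proof -
  have u: "exp ((m k - 1) * \<gamma>) * exp (- C * m k) \<le> exp (m k * u k - \<gamma>)"
      "exp (m k * u k - \<gamma>) \<le> exp ((m k - 1) * \<gamma>) * exp (C * m k)"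
    and v: "1 + exp (n k * v k) \<le> 1 + exp (n k * (\<gamma> + C))"
      "1 + exp (n k * (\<gamma> - C)) \<le> 1 + exp (n k * v k)" if "k \<in> {1..M}" for k
  proof -
    have "m k * (\<gamma> - C) \<le> m k * u k" "m k * u k \<le> m k * (\<gamma> + C)"
      using assms(1)[of k] params[OF that] by (auto intro!: mult_left_mono)
    then show "exp ((m k - 1) * \<gamma>) * exp (- C * m k) \<le> exp (m k * u k - \<gamma>)"
      "exp (m k * u k - \<gamma>) \<le> exp ((m k - 1) * \<gamma>) * exp (C * m k)"
      by (simp_all add: algebra_simps flip: exp_add)
    show "1 + exp (n k * v k) \<le> 1 + exp (n k * (\<gamma> + C))"
      "1 + exp (n k * (\<gamma> - C)) \<le> 1 + exp (n k * v k)"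
      using assms(2)[of k] params[OF that] by auto
  qed
  have pos: "0 \<le> lam k * r k t" if "k \<in> {1..M}" for k
    using params[OF that] coeff_facts(2)[OF that, of t] by simp
  have terms: "exp ((m k - 1) * \<gamma>) * exp (- C * m k) / (1 + exp (n k * (\<gamma> + C)))
        \<le> exp (m k * u k - \<gamma>) / (1 + exp (n k * v k))"
      "exp (m k * u k - \<gamma>) / (1 + exp (n k * v k))
        \<le> exp ((m k - 1) * \<gamma>) * exp (C * m k) / (1 + exp (n k * (\<gamma> - C)))" if "k \<in> {1..M}" for k
    by (rule frac_le[OF _ u(1)[OF that] _ v(1)[OF that]], simp, simp add: add_pos_pos)
      (rule frac_le[OF _ u(2)[OF that] _ v(2)[OF that]], simp, simp add: add_pos_pos)
  show "alpha T M lam m n r b \<gamma> t \<le> log_rhs t \<gamma> u v"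
    unfolding alpha_def log_rhs_def Let_def
    by (rule diff_right_mono, rule sum_mono, rule mult_left_mono[OF terms(1) pos])
  show "log_rhs t \<gamma> u v \<le> beta T M lam m n r b \<gamma> t"
    unfolding beta_def log_rhs_def Let_def
    by (rule diff_right_mono, rule sum_mono, rule mult_left_mono[OF terms(2) pos])
qed

text \<open>The factor a treats in one proof a field pointing into the band (a > 0) and out of it (a
  < 0). The sign conditions range over all delayed values within C of the level, because the
  oscillation bound is all that is known about them.\<close>

lemma solution_between:
  assumes "lo < hi" "a \<noteq> 0"
    and lo: "\<And>t u v. (\<And>k. u k \<in> {lo - C..lo + C}) \<Longrightarrow> (\<And>k. v k \<in> {lo - C..lo + C}) \<Longrightarrow>
      0 < a * log_rhs t lo u v"
    and hi: "\<And>t u v. (\<And>k. u k \<in> {hi - C..hi + C}) \<Longrightarrow> (\<And>k. v k \<in> {hi - C..hi + C}) \<Longrightarrow>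
      a * log_rhs t hi u v < 0"
  obtains x where "x \<in> positive_periodic_solutions T M lam m n r \<tau> \<mu> b"
    "\<And>t. exp lo < x t" "\<And>t. x t < exp hi"
proof -
  define c where "c y t = max lo (min hi (y t))" for y :: "real \<Rightarrow> real" and t
  define cl where "cl z w = max (z - C) (min (z + C) w)" for z w :: real
  define H where "H y t = log_rhs t (c y t) (\<lambda>k. cl (c y t) (y (t - \<tau> k t))) (\<lambda>k. cl (c y t) (y (t - \<mu> k t)))"
    for y t
  \<comment> \<open>All arguments of \<open>log_rhs\<close> are clipped, so g is bounded
    independently of y. A fixed point of F solves y' = H + a (c - y).\<close>
  define g where "g y t = a * c y t + H y t" for y t
  define F where "F y = green T a (g y)" for y
  have cl: "cl z w \<in> {z - C..z + C}" for z w
    using C_nonneg by (auto simp: cl_def)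
  have c: "c y t \<in> {lo..hi}" for y t
    using \<open>lo < hi\<close> by (auto simp: c_def)
  have g_cont: "continuous_on UNIV (g y)" if "continuous_on UNIV y" for y
  proof -
    have delay: "continuous_on UNIV (\<lambda>t. y (t - h t))" if "continuous_on UNIV h" for h
      by (rule continuous_on_compose2[OF \<open>continuous_on UNIV y\<close>]) (intro continuous_intros that, simp)
    have c_cont: "continuous_on UNIV (c y)"
      unfolding c_def by (intro continuous_intros that)
    have clip: "continuous_on UNIV (\<lambda>t. cl (c y t) (w t))" if "continuous_on UNIV w" for w
      unfolding cl_def by (intro continuous_intros c_cont that)
    have pos: "1 + exp (z :: real) \<noteq> 0" for z
      using exp_gt_zero[of z] by linarith
    show ?thesis
      unfolding g_def H_def log_rhs_def
      by (intro continuous_on_add continuous_on_diff continuous_on_sum continuous_on_mult continuous_on_divide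
          continuous_on_exp continuous_on_const clip delay c_cont coeff_facts decay_facts ballI pos)
  qed
  have g_periodic: "periodic_fun_simple (g y) T" if "periodic_fun_simple y T" for y
  proof
    interpret y: periodic_fun_simple y T by fact
    fix t
    have "y (t + T - h) = y (t - h)" for h
      using y.plus_period[of "t - h"] by (simp add: algebra_simps)
    moreover have "b (t + T) = b t"
      using decay_facts(3) by (rule periodic_fun_simple.plus_period)
    moreover have "r k (t + T) = r k t" "\<tau> k (t + T) = \<tau> k t" "\<mu> k (t + T) = \<mu> k t" if "k \<in> {1..M}" for k
      using coeff_facts(3,5,7)[OF that] by (auto dest: periodic_fun_simple.plus_period)
    ultimately show "g y (t + T) = g y t"
      unfolding g_def H_def log_rhs_def c_def by (auto simp: y.plus_period intro!: sum.cong)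
  qed
  obtain \<rho> B where \<rho>: "\<And>k t. k \<in> {1..M} \<Longrightarrow> r k t \<le> \<rho> k" "\<And>k. k \<in> {1..M} \<Longrightarrow> 0 < \<rho> k"
    and B: "\<And>t. b t \<le> B" "0 < B"
    using coeff_upper_bounds by blast
  \<comment> \<open>The present value lies in [lo, hi], the delayed ones are at most hi + C, and the
    denominators are at least 1.\<close>
  define K where "K = \<bar>a\<bar> * (\<bar>lo\<bar> + \<bar>hi\<bar>) + (\<Sum>k = 1..M. lam k * \<rho> k * exp (m k * (hi + C) - lo)) + B"
  have g_bound: "\<bar>g y t\<bar> \<le> K" for y t
  proof -
    let ?S = "\<Sum>k = 1..M. lam k * r k t * (exp (m k * cl (c y t) (y (t - \<tau> k t)) - c y t) /
        (1 + exp (n k * cl (c y t) (y (t - \<mu> k t)))))"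
    have "0 \<le> ?S"
      by (intro sum_nonneg mult_nonneg_nonneg divide_nonneg_nonneg)
        (use params coeff_facts(2) in \<open>auto intro: less_imp_le add_nonneg_nonneg\<close>)
    moreover have "?S \<le> (\<Sum>k = 1..M. lam k * \<rho> k * exp (m k * (hi + C) - lo))"
    proof (intro sum_mono mult_mono)
      fix k assume k: "k \<in> {1..M}"
      show "lam k \<le> lam k" "r k t \<le> \<rho> k" "0 \<le> lam k" "0 \<le> r k t" "0 \<le> lam k * \<rho> k"
        using params[OF k] \<rho>[OF k] coeff_facts(2)[OF k] by (auto intro: less_imp_le)
      have "m k * cl (c y t) (y (t - \<tau> k t)) \<le> m k * (hi + C)"
        using params[OF k] cl[of "c y t" "y (t - \<tau> k t)"] c[of y t] by (intro mult_left_mono) auto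
      then have "exp (m k * cl (c y t) (y (t - \<tau> k t)) - c y t) \<le> exp (m k * (hi + C) - lo)"
        using c[of y t] by auto
      then show "exp (m k * cl (c y t) (y (t - \<tau> k t)) - c y t) / (1 + exp (n k * cl (c y t) (y (t - \<mu> k t))))
          \<le> exp (m k * (hi + C) - lo)"
        by (subst pos_divide_le_eq) (auto intro: add_pos_pos order_trans simp: distrib_left)
    qed (auto intro!: divide_nonneg_nonneg add_nonneg_nonneg)
    moreover have "\<bar>a * c y t\<bar> \<le> \<bar>a\<bar> * (\<bar>lo\<bar> + \<bar>hi\<bar>)"
      unfolding abs_mult using c[of y t] by (intro mult_left_mono) auto
    moreover have "0 < b t" "b t \<le> B"
      using decay_facts(2) B by auto
    ultimately show ?thesis
      unfolding g_def H_def log_rhs_def K_def by linarith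
  qed
  have K_nonneg: "0 \<le> K"
    using g_bound[of _ 0] abs_ge_zero order_trans by blast
  define R where "R = exp (\<bar>a\<bar> * T) * K * T / \<bar>exp (a * T) - 1\<bar> + 1"
  have R_pos: "0 < R"
    unfolding R_def using K_nonneg T_pos by (intro add_nonneg_pos) auto
  define X where "X = {y. continuous_on UNIV y \<and> periodic_fun_simple y T \<and> (\<forall>t. \<bar>y t\<bar> \<le> R)}"
  have F_deriv: "(F y has_real_derivative g y t - a * F y t) (at t)" if "y \<in> X" for y t
    unfolding F_def using that T_pos \<open>a \<noteq> 0\<close>
    by (intro green_has_derivative g_cont g_periodic) (auto simp: X_def)
  have F_bound: "\<bar>F y t\<bar> \<le> R" if "y \<in> X" for y t
    using green_bound[OF T_pos g_cont g_bound, of y a t] that by (simp add: F_def R_def X_def)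
  have "\<exists>y. y \<in> X \<and> F y = y"
  proof (rule periodic_schauder[OF T_pos R_pos, folded X_def, of "K + \<bar>a\<bar> * R" F])
    show "0 \<le> K + \<bar>a\<bar> * R"
      using K_nonneg R_pos by simp
    show "F y \<in> X" if "y \<in> X" for y
      unfolding X_def
    proof (intro CollectI conjI allI)
      show "continuous_on UNIV (F y)"
        using F_deriv[OF that] by (auto intro!: continuous_at_imp_continuous_on DERIV_isCont)
      show "periodic_fun_simple (F y) T"
        using that unfolding F_def X_def by (intro green_periodic g_periodic) auto
      show "\<bar>F y t\<bar> \<le> R" for t
        by (rule F_bound[OF that])
    qed
    show "\<bar>F y s - F y t\<bar> \<le> (K + \<bar>a\<bar> * R) * \<bar>s - t\<bar>" if "y \<in> X" for y s t
    proof -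
      have "norm (F y s - F y t) \<le> (K + \<bar>a\<bar> * R) * norm (s - t)"
      proof (rule field_differentiable_bound[of UNIV])
        fix z
        show "(F y has_field_derivative g y z - a * F y z) (at z within UNIV)"
          using F_deriv[OF that] by simp
        have "\<bar>a * F y z\<bar> \<le> \<bar>a\<bar> * R"
          unfolding abs_mult using F_bound[OF that] by (intro mult_left_mono) auto
        then show "norm (g y z - a * F y z) \<le> K + \<bar>a\<bar> * R"
          using g_bound[of y z] by simp
      qed auto
      then show ?thesis by simp
    qed
    show "(\<lambda>i. F (Y i) t) \<longlonglongrightarrow> F y t"
      if "\<And>i. Y i \<in> X" "y \<in> X" "\<And>s. (\<lambda>i. Y i s) \<longlonglongrightarrow> y s" for Y :: "nat \<Rightarrow> real \<Rightarrow> real" and y t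
      unfolding F_def
    proof (rule green_tendsto)
      show "continuous_on UNIV (g (Y i))" for i
        using that(1) by (intro g_cont) (auto simp: X_def)
      show "\<bar>g (Y i) t\<bar> \<le> K" for i t
        by (rule g_bound)
      show "(\<lambda>i. g (Y i) t) \<longlonglongrightarrow> g y t" for t
        unfolding g_def H_def log_rhs_def c_def cl_def
        by (intro tendsto_intros that(3)) (auto simp: add_pos_pos less_imp_neq[symmetric])
    qed
  qed blast
  then obtain y where y: "y \<in> X" "F y = y" by blast
  have y': "(y has_real_derivative a * (c y t - y t) + H y t) (at t)" for t
    using F_deriv[OF y(1), of t] by (simp add: y(2) g_def algebra_simps)
  have yX: "continuous_on UNIV y" "periodic_fun_simple y T"
    using y(1) by (auto simp: X_def)
  obtain s1 where s1: "\<And>t. y t \<le> y s1"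
    using continuous_periodic_attains_sup[OF yX T_pos] by blast
  obtain s2 where s2: "\<And>t. y s2 \<le> y t"
    using continuous_periodic_attains_inf[OF yX T_pos] by blast
  have "y s1 < hi"
  proof (rule ccontr)
    assume "\<not> y s1 < hi"
    then have eq: "c y s1 = hi"
      using \<open>lo < hi\<close> by (simp add: c_def)
    have "a * (c y s1 - y s1) + H y s1 = 0"
      by (rule DERIV_local_max[OF y', of 1]) (use s1 in auto)
    \<comment> \<open>Multiplying by a gives the clipping term the factor a * a, so its sign is that
      of hi - y whatever the sign of a, and \<open>hi\<close> yields the contradiction.\<close>
    then have "a * a * (hi - y s1) + a * H y s1 = 0"
      unfolding eq by (metis distrib_left mult.assoc mult_zero_right)
    moreover have "a * a * (hi - y s1) \<le> 0"
      using \<open>\<not> y s1 < hi\<close> by (intro mult_nonneg_nonpos) auto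
    moreover have "a * H y s1 < 0"
      unfolding H_def eq by (intro hi cl)
    ultimately show False by linarith
  qed
  moreover have "lo < y s2"
  proof (rule ccontr)
    assume "\<not> lo < y s2"
    then have eq: "c y s2 = lo"
      using \<open>lo < hi\<close> by (simp add: c_def)
    have "a * (c y s2 - y s2) + H y s2 = 0"
      by (rule DERIV_local_min[OF y', of 1]) (use s2 in auto)
    then have "a * a * (lo - y s2) + a * H y s2 = 0"
      unfolding eq by (metis distrib_left mult.assoc mult_zero_right)
    moreover have "0 \<le> a * a * (lo - y s2)"
      using \<open>\<not> lo < y s2\<close> by (intro mult_nonneg_nonneg[OF zero_le_square]) auto
    moreover have "0 < a * H y s2"
      unfolding H_def eq by (intro lo cl)
    ultimately show False by linarith
  qed
  ultimately have between: "lo < y t" "y t < hi" for t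
    using s1[of t] s2[of t] by linarith+
  then have c_eq: "c y t = y t" for t
    using less_imp_le[OF between(1)[of t]] less_imp_le[OF between(2)[of t]] by (simp add: c_def)
  have y'': "(y has_real_derivative H y t) (at t)" for t
    using y'[of t] by (simp add: c_eq)
  \<comment> \<open>This bound holds while the delayed values are still clipped. Hence
    \<open>oscillation_le_C\<close> applies already, and it shows that this clipping changes
    nothing.\<close>
  have "- b t \<le> H y t" for t
  proof -
    have "0 \<le> H y t + b t"
      unfolding H_def log_rhs_def diff_add_cancel
      by (intro sum_nonneg mult_nonneg_nonneg divide_nonneg_nonneg)
        (use params coeff_facts(2) in \<open>auto intro: less_imp_le add_nonneg_nonneg\<close>)
    then show ?thesis by simp
  qed
  from oscillation_le_C[OF yX(2) y'' this] have "cl (y t) (y s) = y s" for s t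
    unfolding cl_def by (smt (verit))
  then have H_eq: "H y t = log_rhs t (y t) (\<lambda>k. y (t - \<tau> k t)) (\<lambda>k. y (t - \<mu> k t))" for t
    by (simp add: H_def c_eq)
  show thesis
  proof (rule that[of "\<lambda>t. exp (y t)"])
    show "(\<lambda>t. exp (y t)) \<in> positive_periodic_solutions T M lam m n r \<tau> \<mu> b"
      unfolding positive_periodic_solutions_def
    proof (intro CollectI conjI allI)
      show "periodic_fun_simple (\<lambda>t. exp (y t)) T"
        using yX(2) by (simp add: periodic_fun_simple_def)
      fix t
      have "exp (y t) * H y t = (\<Sum>k = 1..M. lam k * r k t *
          (exp (y (t - \<tau> k t)) powr m k / (1 + exp (y (t - \<mu> k t)) powr n k))) - b t * exp (y t)"
        by (simp add: H_eq log_rhs_def right_diff_distrib sum_distrib_left powr_def exp_diff mult_ac)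
      moreover have "((\<lambda>t. exp (y t)) has_real_derivative exp (y t) * H y t) (at t)"
        by (rule DERIV_chain2[OF DERIV_exp y''])
      ultimately show "((\<lambda>t. exp (y t)) has_real_derivative (\<Sum>k = 1..M. lam k * r k t *
          (exp (y (t - \<tau> k t)) powr m k / (1 + exp (y (t - \<mu> k t)) powr n k))) - b t * exp (y t)) (at t)"
        by simp
    qed simp
  qed (use between in auto)
qed

end

section \<open>Outer levels and the number of solutions\<close>

context delay_equation
begin

abbreviation "\<alpha> \<equiv> alpha T M lam m n r b"
abbreviation "\<beta> \<equiv> beta T M lam m n r b"
abbreviation "solutions \<equiv> positive_periodic_solutions T M lam m n r \<tau> \<mu> b"

lemma solution_between_alpha_beta:
  assumes "lo < hi" "\<And>t. 0 < \<alpha> lo t" "\<And>t. \<beta> hi t < 0"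
  obtains x where "x \<in> solutions" "\<And>t. exp lo < x t" "\<And>t. x t < exp hi"
proof (rule solution_between[of lo hi "1"])
  fix t u v
  show "0 < 1 * log_rhs t lo u v" if "\<And>k. u k \<in> {lo - C..lo + C}" "\<And>k. v k \<in> {lo - C..lo + C}"
    using alpha_le_log_rhs_le_beta(1)[of u lo v, OF that, of t] assms(2)[of t] by simp
  show "1 * log_rhs t hi u v < 0" if "\<And>k. u k \<in> {hi - C..hi + C}" "\<And>k. v k \<in> {hi - C..hi + C}"
    using alpha_le_log_rhs_le_beta(2)[of u hi v, OF that, of t] assms(3)[of t] by simp
qed (use assms in auto)

text \<open>Here the field points out of the band. The choice a = -1 is admissible because
  \<open>green\<close> solves the linear periodic problem for negative a as well.\<close>

lemma solution_between_beta_alpha: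
  assumes "lo < hi" "\<And>t. \<beta> lo t < 0" "\<And>t. 0 < \<alpha> hi t"
  obtains x where "x \<in> solutions" "\<And>t. exp lo < x t" "\<And>t. x t < exp hi"
proof (rule solution_between[of lo hi "- 1"])
  fix t u v
  show "0 < - 1 * log_rhs t lo u v" if "\<And>k. u k \<in> {lo - C..lo + C}" "\<And>k. v k \<in> {lo - C..lo + C}"
    using alpha_le_log_rhs_le_beta(2)[of u lo v, OF that, of t] assms(2)[of t] by simp
  show "- 1 * log_rhs t hi u v < 0" if "\<And>k. u k \<in> {hi - C..hi + C}" "\<And>k. v k \<in> {hi - C..hi + C}"
    using alpha_le_log_rhs_le_beta(1)[of u hi v, OF that, of t] assms(3)[of t] by simp
qed (use assms in auto)

text \<open>Dropping the 1 in the denominator leaves a multiple of exp((m - 1 - n) \<gamma>), which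
  decays since m < n + 1. Replacing each r by an upper bound and b by its minimum makes the choice
  of \<gamma> independent of t.\<close>

lemma beta_negative_at_top:
  assumes mn: "\<And>k. k \<in> {1..M} \<Longrightarrow> m k < n k + 1"
  obtains \<gamma> where "\<delta> < \<gamma>" "\<And>t. \<beta> \<gamma> t < 0"
proof -
  obtain \<rho> where \<rho>: "\<And>k t. k \<in> {1..M} \<Longrightarrow> r k t \<le> \<rho> k" "\<And>k. k \<in> {1..M} \<Longrightarrow> 0 < \<rho> k"
    using coeff_upper_bounds by metis
  obtain s where s: "\<And>t. b s \<le> b t"
    using continuous_periodic_attains_inf[OF decay_facts(1,3) T_pos] by blast
  define q where "q k \<gamma> = exp ((m k - 1) * \<gamma>) * exp (C * m k) / (1 + exp (n k * (\<gamma> - C)))" for k \<gamma>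
  have q_lim: "(q k \<longlongrightarrow> 0) at_top" if k: "k \<in> {1..M}" for k
  proof (rule Lim_null_comparison)
    have "((\<lambda>\<gamma>. exp (C * m k + n k * C) * exp ((m k - 1 - n k) * \<gamma>)) \<longlongrightarrow>
        exp (C * m k + n k * C) * 0) at_top"
      using mn[OF k] by (intro tendsto_mult tendsto_const tendsto_exp_mult_at_top) simp
    then show "((\<lambda>\<gamma>. exp (C * m k + n k * C) * exp ((m k - 1 - n k) * \<gamma>)) \<longlongrightarrow> 0) at_top"
      by simp
    have "q k \<gamma> \<le> exp ((m k - 1) * \<gamma>) * exp (C * m k) / exp (n k * (\<gamma> - C))" for \<gamma>
      unfolding q_def by (intro divide_left_mono mult_pos_pos add_pos_pos) auto
    also have "exp ((m k - 1) * \<gamma>) * exp (C * m k) / exp (n k * (\<gamma> - C)) =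
        exp (C * m k + n k * C) * exp ((m k - 1 - n k) * \<gamma>)" for \<gamma>
      by (simp add: algebra_simps flip: exp_add exp_diff)
    finally have "norm (q k \<gamma>) \<le> exp (C * m k + n k * C) * exp ((m k - 1 - n k) * \<gamma>)" for \<gamma>
      by (simp add: q_def add_nonneg_nonneg)
    then show "\<forall>\<^sub>F \<gamma> in at_top. norm (q k \<gamma>) \<le> exp (C * m k + n k * C) * exp ((m k - 1 - n k) * \<gamma>)"
      by simp
  qed
  have "((\<lambda>\<gamma>. \<Sum>k = 1..M. lam k * \<rho> k * q k \<gamma>) \<longlongrightarrow> 0) at_top"
    by (intro tendsto_null_sum tendsto_mult_right_zero q_lim)
  then have "\<forall>\<^sub>F \<gamma> in at_top. (\<Sum>k = 1..M. lam k * \<rho> k * q k \<gamma>) < b s"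
    using decay_facts(2)[of s] by (rule order_tendstoD)
  then obtain \<gamma> where \<gamma>: "(\<Sum>k = 1..M. lam k * \<rho> k * q k \<gamma>) < b s" "\<delta> < \<gamma>"
    using eventually_happens'[OF trivial_limit_at_top_linorder eventually_conj[OF _ eventually_gt_at_top]]
    by blast
  have "\<beta> \<gamma> t < 0" for t
  proof -
    have "(\<Sum>k = 1..M. lam k * r k t * q k \<gamma>) \<le> (\<Sum>k = 1..M. lam k * \<rho> k * q k \<gamma>)"
      using params \<rho>
      by (intro sum_mono mult_right_mono mult_left_mono) (auto intro: less_imp_le simp: q_def add_nonneg_nonneg)
    then show ?thesis
      using \<gamma>(1) s[of t] by (simp add: beta_def Let_def q_def)
  qed
  then show thesis
    using that \<gamma>(2) by blast
qed

text \<open>As \<gamma> tends to minus infinity the terms with m > 1 vanish, while those with m = 1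
  stay below the sum in \<open>lin\<close>.\<close>

lemma beta_negative_at_bot:
  assumes m1: "\<And>k. k \<in> {1..M} \<Longrightarrow> 1 \<le> m k"
    and lin: "\<And>t. (\<Sum>k | k \<in> {1..M} \<and> m k = 1. lam k * r k t * exp C) < b t"
  obtains \<gamma> where "\<gamma> < \<delta>" "\<And>t. \<beta> \<gamma> t < 0"
proof -
  obtain \<rho> where \<rho>: "\<And>k t. k \<in> {1..M} \<Longrightarrow> r k t \<le> \<rho> k" "\<And>k. k \<in> {1..M} \<Longrightarrow> 0 < \<rho> k"
    using coeff_upper_bounds by metis
  \<comment> \<open>\<open>lin\<close> is a pointwise condition; the minimum of the continuous
    periodic gap h turns it into a positive margin uniform in t.\<close>
  define h where "h t = b t - (\<Sum>k | k \<in> {1..M} \<and> m k = 1. lam k * r k t * exp C)" for t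
  have "continuous_on UNIV h"
    unfolding h_def by (intro continuous_intros decay_facts coeff_facts) auto
  moreover have "periodic_fun_simple h T"
  proof
    have "r k (t + T) = r k t" if "k \<in> {1..M}" for k t
      using coeff_facts(3)[OF that] by (rule periodic_fun_simple.plus_period)
    moreover have "b (t + T) = b t" for t
      using decay_facts(3) by (rule periodic_fun_simple.plus_period)
    ultimately show "h (t + T) = h t" for t
      by (auto simp: h_def intro!: sum.cong)
  qed
  ultimately obtain s where s: "\<And>t. h s \<le> h t"
    using continuous_periodic_attains_inf T_pos by blast
  define q where "q k \<gamma> = exp ((m k - 1) * \<gamma>) * exp (C * m k) / (1 + exp (n k * (\<gamma> - C)))" for k \<gamma>
  have q_nonneg: "0 \<le> q k \<gamma>" for k \<gamma>
    by (simp add: q_def add_nonneg_nonneg)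
  have q_le: "q k \<gamma> \<le> exp ((m k - 1) * \<gamma>) * exp (C * m k)" for k \<gamma>
    using divide_left_mono[of 1 "1 + exp (n k * (\<gamma> - C))" "exp ((m k - 1) * \<gamma>) * exp (C * m k)"]
    by (simp add: q_def add_pos_pos)
  define Q where "Q \<gamma> = (\<Sum>k = 1..M. if m k = 1 then 0 else lam k * \<rho> k * q k \<gamma>)" for \<gamma>
  have "(Q \<longlongrightarrow> 0) at_bot"
    unfolding Q_def
  proof (rule tendsto_null_sum)
    fix k assume k: "k \<in> {1..M}"
    show "((\<lambda>\<gamma>. if m k = 1 then 0 else lam k * \<rho> k * q k \<gamma>) \<longlongrightarrow> 0) at_bot"
    proof (cases "m k = 1")
      case False
      have "(q k \<longlongrightarrow> 0) at_bot"
      proof (rule Lim_null_comparison)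
        have "((\<lambda>\<gamma>. exp ((m k - 1) * \<gamma>) * exp (C * m k)) \<longlongrightarrow> 0 * exp (C * m k)) at_bot"
          using m1[OF k] False by (intro tendsto_mult tendsto_const tendsto_exp_mult_at_bot) simp
        then show "((\<lambda>\<gamma>. exp ((m k - 1) * \<gamma>) * exp (C * m k)) \<longlongrightarrow> 0) at_bot"
          by simp
        show "\<forall>\<^sub>F \<gamma> in at_bot. norm (q k \<gamma>) \<le> exp ((m k - 1) * \<gamma>) * exp (C * m k)"
          using q_nonneg q_le by simp
      qed
      then show ?thesis
        using False by (simp add: tendsto_mult_right_zero)
    qed simp
  qed
  moreover have "0 < h s"
    using lin by (simp add: h_def)
  ultimately have "\<forall>\<^sub>F \<gamma> in at_bot. Q \<gamma> < h s"
    by (rule order_tendstoD)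
  then obtain \<gamma> where \<gamma>: "Q \<gamma> < h s" "\<gamma> < \<delta>"
    using eventually_happens'[OF trivial_limit_at_bot_linorder eventually_conj[OF _ eventually_gt_at_bot]]
    by blast
  have "\<beta> \<gamma> t < 0" for t
  proof -
    have "(\<Sum>k = 1..M. lam k * r k t * q k \<gamma>) \<le>
      (\<Sum>k = 1..M. (if m k = 1 then lam k * r k t * exp C else 0) +
        (if m k = 1 then 0 else lam k * \<rho> k * q k \<gamma>))"
    proof (rule sum_mono)
      fix k assume k: "k \<in> {1..M}"
      have "lam k * r k t * q k \<gamma> \<le> lam k * r k t * exp C" if "m k = 1"
        using q_le[of k \<gamma>] that params[OF k] coeff_facts(2)[OF k, of t] by (intro mult_left_mono) auto
      moreover have "lam k * r k t * q k \<gamma> \<le> lam k * \<rho> k * q k \<gamma>"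
        using \<rho>(1)[OF k, of t] params[OF k] q_nonneg by (intro mult_right_mono mult_left_mono) auto
      ultimately show "lam k * r k t * q k \<gamma> \<le> (if m k = 1 then lam k * r k t * exp C else 0) +
          (if m k = 1 then 0 else lam k * \<rho> k * q k \<gamma>)"
        by simp
    qed
    also have "\<dots> = b t - h t + Q \<gamma>"
      by (simp add: sum.distrib h_def Q_def sum.inter_filter[symmetric])
    finally show ?thesis
      using \<gamma>(1) s[of t] by (simp add: beta_def Let_def q_def)
  qed
  then show thesis
    using that \<gamma>(2) by blast
qed

text \<open>For m i < 1 the factor exp((m i - 1) \<gamma>) grows without bound as \<gamma> tends to
  minus infinity. The other terms are nonnegative, so term i alone exceeds an upper bound of
  b.\<close>

lemma alpha_positive_at_bot:
  assumes i: "i \<in> {1..M}" and "m i < 1"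
  obtains \<gamma> where "\<gamma> < \<delta>" "\<And>t. 0 < \<alpha> \<gamma> t"
proof -
  obtain B where B: "\<And>t. b t \<le> B" "0 < B"
    using coeff_upper_bounds by metis
  obtain s where s: "\<And>t. r i s \<le> r i t"
    using continuous_periodic_attains_inf[OF coeff_facts(1,3)[OF i] T_pos] by blast
  define K where "K = lam i * r i s * (exp (- C * m i) / (1 + exp (n i * C)))"
  have K: "0 < K"
    unfolding K_def using params[OF i] coeff_facts(2)[OF i] by (intro mult_pos_pos divide_pos_pos add_pos_pos) auto
  \<comment> \<open>The first entry puts \<gamma> below \<delta>, the 0 bounds the denominator by
    its value at \<gamma> = 0, and the last entry gives (m i - 1) \<gamma> > ln (B / K); dividing by
    the negative m i - 1 turns a lower bound into an upper one.\<close>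
  define \<gamma> where "\<gamma> = min (\<delta> - 1) (min 0 ((ln (B / K) + 1) / (m i - 1)))"
  have "\<gamma> * (m i - 1) \<ge> (ln (B / K) + 1) / (m i - 1) * (m i - 1)"
    using assms(2) by (intro mult_right_mono_neg) (auto simp: \<gamma>_def)
  then have "ln (B / K) < (m i - 1) * \<gamma>"
    using assms(2) by (simp add: mult.commute)
  then have "exp (ln (B / K)) < exp ((m i - 1) * \<gamma>)"
    by simp
  then have "B / K < exp ((m i - 1) * \<gamma>)"
    using B K by simp
  then have BK: "B < exp ((m i - 1) * \<gamma>) * K"
    using K by (simp add: pos_divide_less_eq)
  define p where "p k = exp ((m k - 1) * \<gamma>) * exp (- C * m k) / (1 + exp (n k * (\<gamma> + C)))" for k
  have p_nonneg: "0 \<le> p k" for k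
    by (simp add: p_def add_nonneg_nonneg)
  have "0 < \<alpha> \<gamma> t" for t
  proof -
    have "exp ((m i - 1) * \<gamma>) * K = lam i * r i s * (exp ((m i - 1) * \<gamma>) * exp (- C * m i) / (1 + exp (n i * C)))"
      by (simp add: K_def)
    also have "\<dots> \<le> lam i * r i t * p i"
    proof (intro mult_mono)
      have "\<gamma> \<le> 0"
        by (simp add: \<gamma>_def)
      then have "n i * (\<gamma> + C) \<le> n i * C"
        using params[OF i] by (intro mult_left_mono) auto
      then show "exp ((m i - 1) * \<gamma>) * exp (- C * m i) / (1 + exp (n i * C)) \<le> p i"
        unfolding p_def by (intro divide_left_mono mult_pos_pos add_pos_pos) auto
    qed (use params[OF i] coeff_facts(2)[OF i] s in \<open>auto intro!: less_imp_le mult_pos_pos divide_pos_pos add_pos_pos\<close>)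
    also have "\<dots> \<le> (\<Sum>k = 1..M. lam k * r k t * p k)"
      by (rule member_le_sum[OF i])
        (use params coeff_facts(2) p_nonneg in \<open>auto intro!: mult_nonneg_nonneg intro: less_imp_le\<close>)
    finally show ?thesis
      using BK B(1)[of t] by (simp add: alpha_def Let_def p_def)
  qed
  moreover have "\<gamma> < \<delta>"
    by (simp add: \<gamma>_def)
  ultimately show thesis
    using that by blast
qed

text \<open>The levels \<gamma>0 < \<gamma>1 < \<gamma>2 carry the signs -, +, -. Each sign change
  gives a solution, and the level exp \<gamma>1 separates the two.\<close>

lemma two_solutions:
  assumes mn: "\<And>k. k \<in> {1..M} \<Longrightarrow> m k < n k + 1" and m1: "\<And>k. k \<in> {1..M} \<Longrightarrow> 1 \<le> m k"
    and lin: "\<And>t. (\<Sum>k | k \<in> {1..M} \<and> m k = 1. lam k * r k t * exp C) < b t"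
    and \<gamma>1: "\<And>t. 0 < \<alpha> \<gamma>1 t"
  shows "has_at_least 2 solutions"
proof -
  obtain \<gamma>0 where \<gamma>0: "\<gamma>0 < \<gamma>1" "\<And>t. \<beta> \<gamma>0 t < 0"
    by (rule beta_negative_at_bot[where \<delta> = \<gamma>1, OF m1 lin]) (assumption+, rule that)
  obtain x where x: "x \<in> solutions" "\<And>t. exp \<gamma>0 < x t" "\<And>t. x t < exp \<gamma>1"
    by (rule solution_between_beta_alpha[OF \<gamma>0 \<gamma>1]) (rule that)
  obtain \<gamma>2 where \<gamma>2: "\<gamma>1 < \<gamma>2" "\<And>t. \<beta> \<gamma>2 t < 0"
    by (rule beta_negative_at_top[where \<delta> = \<gamma>1, OF mn]) (assumption+, rule that)
  obtain y where y: "y \<in> solutions" "\<And>t. exp \<gamma>1 < y t" "\<And>t. y t < exp \<gamma>2"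
    by (rule solution_between_alpha_beta[OF \<gamma>2(1) \<gamma>1 \<gamma>2(2)]) (rule that)
  have "x \<noteq> y"
    using x(3)[of 0] y(2)[of 0] by auto
  then show ?thesis
    by (rule has_at_least_2[OF x(1) y(1)])
qed

text \<open>Four levels with signs +, -, +, -: the two given ones, a lower one from the exponent
  below 1, and an upper one from m < n + 1. The three bands between them are disjoint.\<close>

lemma three_solutions:
  assumes mn: "\<And>k. k \<in> {1..M} \<Longrightarrow> m k < n k + 1" and i: "i \<in> {1..M}" "m i < 1"
    and \<gamma>: "\<gamma>1 < \<gamma>2" "\<And>t. 0 < \<alpha> \<gamma>2 t" "\<And>t. \<beta> \<gamma>1 t < 0"
  shows "has_at_least 3 solutions"
proof -
  obtain \<gamma>0 where \<gamma>0: "\<gamma>0 < \<gamma>1" "\<And>t. 0 < \<alpha> \<gamma>0 t"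
    by (rule alpha_positive_at_bot[where \<delta> = \<gamma>1, OF i]) (rule that)
  obtain x where x: "x \<in> solutions" "\<And>t. exp \<gamma>0 < x t" "\<And>t. x t < exp \<gamma>1"
    by (rule solution_between_alpha_beta[OF \<gamma>0 \<gamma>(3)]) (rule that)
  obtain y where y: "y \<in> solutions" "\<And>t. exp \<gamma>1 < y t" "\<And>t. y t < exp \<gamma>2"
    by (rule solution_between_beta_alpha[OF \<gamma>(1,3,2)]) (rule that)
  obtain \<gamma>3 where \<gamma>3: "\<gamma>2 < \<gamma>3" "\<And>t. \<beta> \<gamma>3 t < 0"
    by (rule beta_negative_at_top[where \<delta> = \<gamma>2, OF mn]) (assumption+, rule that)
  obtain z where z: "z \<in> solutions" "\<And>t. exp \<gamma>2 < z t" "\<And>t. z t < exp \<gamma>3"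
    by (rule solution_between_alpha_beta[OF \<gamma>3(1) \<gamma>(2) \<gamma>3(2)]) (rule that)
  have "x 0 < y 0" "y 0 < z 0"
    using x(3)[of 0] y(2,3)[of 0] z(2)[of 0] by linarith+
  then have "x \<noteq> y" "y \<noteq> z" "x \<noteq> z"
    by auto
  then show ?thesis
    by (rule has_at_least_3[OF x(1) y(1) z(1)])
qed

end

theorem theorem3p2:
  fixes T :: real and M :: nat
    and lam m n :: "nat \<Rightarrow> real"
    and r \<tau> \<mu> :: "nat \<Rightarrow> real \<Rightarrow> real"
    and b :: "real \<Rightarrow> real"
  assumes "0 < T" and "1 \<le> M"
    and "\<forall>k \<in> {1..M}. 0 < lam k \<and> 0 < m k \<and> 0 < n k"
    and "\<forall>k \<in> {1..M}. continuous_positive_periodic T (r k)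
           \<and> continuous_positive_periodic T (\<tau> k)
           \<and> continuous_positive_periodic T (\<mu> k)"
    and "continuous_positive_periodic T b"
    and "\<forall>k \<in> {1..M}. m k < n k + 1"
  shows
    "((\<forall>k \<in> {1..M}. 1 < m k) \<and>
      (\<exists>\<gamma>1. \<forall>t. 0 < alpha T M lam m n r b \<gamma>1 t)
        \<longrightarrow> has_at_least 2 (positive_periodic_solutions T M lam m n r \<tau> \<mu> b))
   \<and> ((\<forall>k \<in> {1..M}. 1 \<le> m k) \<and>
      (\<exists>i \<in> {1..M}. \<exists>j \<in> {1..M}. m i = 1 \<and> 1 < m j) \<and>
      (\<forall>t. (\<Sum>k | k \<in> {1..M} \<and> m k = 1. lam k * r k t * exp (total_decay T b)) < b t) \<and>
      (\<exists>\<gamma>1. \<forall>t. 0 < alpha T M lam m n r b \<gamma>1 t)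
        \<longrightarrow> has_at_least 2 (positive_periodic_solutions T M lam m n r \<tau> \<mu> b))
   \<and> ((\<exists>i \<in> {1..M}. \<exists>j \<in> {1..M}. 0 < m i \<and> m i < 1 \<and> 1 < m j) \<and>
      (\<exists>\<gamma>1 \<gamma>2. \<gamma>1 < \<gamma>2 \<and>
        (\<forall>t. 0 < alpha T M lam m n r b \<gamma>2 t \<and> beta T M lam m n r b \<gamma>1 t < 0))
        \<longrightarrow> has_at_least 3 (positive_periodic_solutions T M lam m n r \<tau> \<mu> b))"
proof -
  interpret delay_equation T M lam m n r \<tau> \<mu> b
    using assms by unfold_locales auto
  have mn: "m k < n k + 1" if "k \<in> {1..M}" for k
    using assms(6) that by blast
  show ?thesis
  proof (intro conjI impI)
    assume *: "(\<forall>k\<in>{1..M}. 1 < m k) \<and> (\<exists>\<gamma>1. \<forall>t. 0 < \<alpha> \<gamma>1 t)"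
    \<comment> \<open>If all exponents exceed 1, the sum over m k = 1 is empty and its condition
      reduces to b > 0, so \<open>two_solutions\<close> covers this case too.\<close>
    then have "{k. k \<in> {1..M} \<and> m k = 1} = {}"
      by fastforce
    then have "(\<Sum>k | k \<in> {1..M} \<and> m k = 1. lam k * r k t * exp C) < b t" for t
      by (simp only: sum.empty decay_facts)
    then show "has_at_least 2 solutions"
      using * by (elim conjE exE) (rule two_solutions[OF mn], auto intro: less_imp_le)
  next
    assume "(\<forall>k\<in>{1..M}. 1 \<le> m k) \<and> (\<exists>i\<in>{1..M}. \<exists>j\<in>{1..M}. m i = 1 \<and> 1 < m j) \<and>
      (\<forall>t. (\<Sum>k | k \<in> {1..M} \<and> m k = 1. lam k * r k t * exp C) < b t) \<and>
      (\<exists>\<gamma>1. \<forall>t. 0 < \<alpha> \<gamma>1 t)"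
    then show "has_at_least 2 solutions"
      by (elim conjE exE) (rule two_solutions[OF mn], auto)
  next
    assume "(\<exists>i\<in>{1..M}. \<exists>j\<in>{1..M}. 0 < m i \<and> m i < 1 \<and> 1 < m j) \<and>
      (\<exists>\<gamma>1 \<gamma>2. \<gamma>1 < \<gamma>2 \<and> (\<forall>t. 0 < \<alpha> \<gamma>2 t \<and> \<beta> \<gamma>1 t < 0))"
    then show "has_at_least 3 solutions"
      by (elim conjE exE bexE) (rule three_solutions[OF mn], auto)
  qed
qed

end
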